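(* Let $\beta>1$ be a quadratic Pisot unit whose algebraic conjugate is negative. Then every rational number $x\in I_\beta\cap(-\infty,0]$ has a purely periodic $(-\beta)$-expansion, and no rational number $x\in I_\beta\cap(0,+\infty)$ has a purely periodic $(-\beta)$-expansion.
   Context: For $\beta>1$ let $I_\beta=\left[-\frac{\beta}{\beta+1},\frac{1}{\beta+1}\right)$ and define $T_{-\beta}:I_\beta\to I_\beta$ by $T_{-\beta}(x)=-\beta x-\left\lfloor -\beta x+\frac{\beta}{\beta+1}\right\rfloor$. For $x\in I_\beta$ put $x_i=\left\lfloor -\beta T_{-\beta}^{i-1}(x)+\frac{\beta}{\beta+1}\right\rfloor\in\{0,1,\dots,\lfloor\beta\rfloor\}$; then $x=\sum_{i\ge1}x_i(-\beta)^{-i}$, and $d_{-\beta}(x):=x_1x_2x_3\cdots$ is the $(-\beta)$-expansion of $x$. It is purely periodic if $d_{-\beta}(x)=(a_1\cdots a_N)^\omega$ for some finite word $a_1\cdots a_N$. *)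

theory Defs
  imports Complex_Main "HOL-Computational_Algebra.Computational_Algebra"
begin

definition is_min_poly :: "rat poly \<Rightarrow> complex \<Rightarrow> bool" where
  "is_min_poly p z \<longleftrightarrow> lead_coeff p = 1 \<and> irreducible p \<and> poly (map_poly of_rat p) z = 0"

text \<open>The conjugates of \<open>z\<close> include \<open>z\<close> itself; the set is empty if \<open>z\<close> is transcendental.\<close>

definition conjugates :: "complex \<Rightarrow> complex set" where
  "conjugates z = {w. \<exists>p. is_min_poly p z \<and> poly (map_poly of_rat p) w = 0}"

definition quadratic :: "real \<Rightarrow> bool" where
  "quadratic \<beta> \<longleftrightarrow> (\<exists>p. is_min_poly p (complex_of_real \<beta>) \<and> degree p = 2)"

definition pisot :: "real \<Rightarrow> bool" where
  "pisot \<beta> \<longleftrightarrow> \<beta> > 1 \<and> algebraic_int \<beta> \<and>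
     (\<forall>w \<in> conjugates (complex_of_real \<beta>) - {complex_of_real \<beta>}. norm w < 1)"

text \<open>A unit of the ring of all algebraic integers.\<close>

definition algebraic_unit :: "real \<Rightarrow> bool" where
  "algebraic_unit \<beta> \<longleftrightarrow> \<beta> \<noteq> 0 \<and> algebraic_int \<beta> \<and> algebraic_int (inverse \<beta>)"

definition I_beta :: "real \<Rightarrow> real set" where
  "I_beta \<beta> = {- \<beta> / (\<beta> + 1) ..< 1 / (\<beta> + 1)}"

text \<open>The transformation is given by its formula on all reals; it maps \<open>I_beta \<beta>\<close> to itself
  and is only of interest there.\<close>

definition T_neg :: "real \<Rightarrow> real \<Rightarrow> real" where
  "T_neg \<beta> x = - \<beta> * x - of_int \<lfloor>- \<beta> * x + \<beta> / (\<beta> + 1)\<rfloor>"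

text \<open>Infinite words are functions on \<^typ>\<open>nat\<close>, indexed from 0: \<open>neg_expansion \<beta> x n\<close> is the digit
  \<open>x\<^sub>n\<^sub>+\<^sub>1\<close> of the expansion \<open>x\<^sub>1 x\<^sub>2 x\<^sub>3 \<dots>\<close>.\<close>

definition neg_expansion :: "real \<Rightarrow> real \<Rightarrow> nat \<Rightarrow> int" where
  "neg_expansion \<beta> x n = \<lfloor>- \<beta> * (T_neg \<beta> ^^ n) x + \<beta> / (\<beta> + 1)\<rfloor>"

definition omega_power :: "'a list \<Rightarrow> nat \<Rightarrow> 'a" where
  "omega_power a n = a ! (n mod length a)"

definition purely_periodic :: "(nat \<Rightarrow> 'a) \<Rightarrow> bool" where
  "purely_periodic d \<longleftrightarrow> (\<exists>a. a \<noteq> [] \<and> d = omega_power a)"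

end

theory Submission
  imports Defs "HOL-Computational_Algebra.Field_as_Ring"
begin

text \<open>Since \<open>\<beta>\<close> is a unit with negative conjugate, \<open>\<beta> \<beta>' = -1\<close> and \<open>\<beta> + \<beta>' = m\<close> is a positive
  integer. On pairs \<open>(x, x')\<close> of conjugate elements of the field of \<open>\<beta>\<close> the transformation acts by
  \<open>(x, y) \<mapsto> (- \<beta> x - d, - \<beta>' y - d)\<close> with \<open>d\<close> the digit of \<open>x\<close>, which expands the first coordinate
  and contracts the second. Its natural extension lives on the set of pairs with \<open>x\<close> in the interval
  and \<open>y\<close> in \<open>[- \<beta> - 1, 0]\<close> or \<open>[- \<beta>, 0]\<close>, according to whether \<open>x \<le> (1 - m) / (\<beta> + 1)\<close> or not.
  The points of that set coming from \<open>(1/q) \<int>[\<beta>]\<close> are finitely many, and the map sends them onto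
  themselves, so it permutes them and all of them are periodic. A rational \<open>x\<close> is its own conjugate,
  and \<open>(x, x)\<close> belongs to the set if \<open>x \<le> 0\<close>. Conversely, digits are nonnegative and \<open>0 < - \<beta>' < 1\<close>,
  so a periodic point with positive conjugate would have that conjugate strictly decreased over a
  period.\<close>

section \<open>Permutations of finite sets\<close>

text \<open>By pigeonhole two iterates of \<open>p\<close> agree, and injectivity of the lower
  iterate on \<open>S\<close> cancels it, so the orbit returns to \<open>p\<close> itself.\<close>

lemma finite_bij_betw_funpow_fixpoint:
  assumes "finite S" and "bij_betw f S S" and "p \<in> S"
  shows "\<exists>N>0. (f ^^ N) p = p"
proof -
  have mem: "(f ^^ n) p \<in> S" for n
    using bij_betw_funpow[OF assms(2)] assms(3) by (meson bij_betwE)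
  have "finite (range (\<lambda>n. (f ^^ n) p))"
    using mem assms(1) by (meson finite_subset image_subsetI)
  then have "\<not> inj (\<lambda>n. (f ^^ n) p)" using finite_imageD infinite_UNIV_nat by blast
  then obtain i j where ij: "i < j" "(f ^^ i) p = (f ^^ j) p"
    by (metis injI linorder_neqE_nat)
  have "(f ^^ (i + (j - i))) p = (f ^^ i) p" using ij by simp
  then have "(f ^^ i) ((f ^^ (j - i)) p) = (f ^^ i) p" by (simp only: funpow_add o_apply)
  moreover have "inj_on (f ^^ i) S"
    using bij_betw_funpow[OF assms(2)] bij_betw_imp_inj_on by blast
  ultimately have "(f ^^ (j - i)) p = p" using mem assms(3) by (auto dest: inj_onD)
  then show ?thesis using ij by (intro exI[of _ "j - i"]) simp
qed

section \<open>Minimal polynomials of algebraic integers and units\<close>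

lemma rat_poly_clear_denominators:
  fixes p :: "rat poly"
  shows "\<exists>a P. a > 0 \<and> smult (of_int a) p = map_poly of_int P"
proof (induction p)
  case 0
  show ?case by (rule exI[of _ 1], rule exI[of _ 0]) simp
next
  case (pCons c p)
  then obtain a P where a: "a > 0" and P: "smult (of_int a) p = map_poly of_int P"
    by blast
  obtain n d where c: "c = of_int n / of_int d" and d: "d > 0"
    by (metis quotient_of_div quotient_of_denom_pos surj_pair)
  have "smult (of_int (a * d)) (pCons c p) = pCons (of_int (a * n)) (smult (of_int d) (smult (of_int a) p))"
    using d by (simp add: c mult.commute)
  also have "\<dots> = map_poly of_int (pCons (a * n) (smult d P))"
    unfolding P by (intro poly_eqI) (simp add: coeff_map_poly coeff_pCons split: nat.splits)
  finally show ?case using a d by (metis mult_pos_pos)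
qed

lemma map_poly_of_int_mult:
  "map_poly (of_int :: int \<Rightarrow> 'a :: {comm_ring_1, ring_char_0}) (p * q) = map_poly of_int p * map_poly of_int q"
  by (intro poly_eqI) (simp add: coeff_map_poly coeff_mult)

lemma map_poly_of_int_eq_iff:
  "map_poly (of_int :: int \<Rightarrow> 'a :: {comm_ring_1, ring_char_0}) p = map_poly of_int q \<longleftrightarrow> p = q"
  by (auto simp: poly_eq_iff coeff_map_poly)

text \<open>Gauss's lemma: clearing the denominator \<open>b\<close> of the quotient gives
  \<open>smult b R = P * S\<close>. Content is multiplicative and \<open>P\<close> is primitive, so
  \<open>b\<close> divides the content of \<open>S\<close> and cancels.\<close>

lemma primitive_int_poly_dvd_if_rat_dvd:
  fixes P R :: "int poly"
  assumes "content P = 1" and "map_poly rat_of_int P dvd map_poly rat_of_int R"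
  shows "P dvd R"
proof -
  obtain s where s: "map_poly rat_of_int R = map_poly rat_of_int P * s"
    using assms(2) by (auto elim: dvdE)
  obtain b S where b: "b > 0" and S: "smult (of_int b) s = map_poly of_int S"
    using rat_poly_clear_denominators by blast
  have "map_poly rat_of_int (smult b R) = smult (of_int b) (map_poly of_int R)"
    by (intro poly_eqI) (simp add: coeff_map_poly)
  also have "\<dots> = map_poly of_int (P * S)"
    by (simp add: s map_poly_of_int_mult flip: S)
  finally have eq: "smult b R = P * S" by (simp add: map_poly_of_int_eq_iff)
  then have "content S = b * content R"
    using assms(1) b by (metis content_mult content_smult mult_1 abs_of_pos normalize_int_def)
  then have "[:b:] dvd S" by (simp add: const_poly_dvd_iff_dvd_content)
  then obtain S' where "S = smult b S'" by (auto elim: dvdE)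
  then have "smult b R = smult b (P * S')" using eq by simp
  then have "R = P * S'" using b by (metis smult_cancel less_irrefl)
  then show ?thesis by simp
qed

text \<open>The primitive integer multiple of \<open>p\<close> divides \<open>Q\<close> by Gauss's
  lemma, so its leading coefficient divides 1. Hence it is \<open>p\<close> up to sign.\<close>

lemma monic_rat_dvd_monic_int_poly:
  fixes p :: "rat poly" and Q :: "int poly"
  assumes "lead_coeff p = 1" and "p dvd map_poly of_int Q" and "lead_coeff Q = 1"
  shows "\<exists>P. p = map_poly of_int P \<and> lead_coeff P = 1"
proof -
  obtain a P0 where a: "a > 0" and P0: "smult (of_int a) p = map_poly of_int P0"
    using rat_poly_clear_denominators by blast
  define P where "P = primitive_part P0"
  define k where "k = content P0"
  have P0': "P0 = smult k P" by (simp add: P_def k_def)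
  have P0n: "P0 \<noteq> 0" using P0 assms(1) a
    by (metis map_poly_0 leading_coeff_0_iff of_int_0_eq_iff smult_eq_0_iff less_irrefl zero_neq_one)
  then have k: "k \<noteq> 0" and cP: "content P = 1" by (simp_all add: k_def P_def)
  have eq: "smult (of_int a) p = smult (of_int k) (map_poly of_int P)"
    unfolding P0 P0' by (intro poly_eqI) (simp add: coeff_map_poly)
  then have eq': "map_poly of_int P = smult (of_int a / of_int k) p"
    using k by (metis (no_types, opaque_lifting) divide_inverse_commute left_inverse of_int_0_eq_iff smult_1_left smult_smult)
  have "map_poly of_int P dvd map_poly rat_of_int Q"
    unfolding eq' using assms(2) a k by (subst smult_dvd_iff) auto
  then have "P dvd Q" using cP primitive_int_poly_dvd_if_rat_dvd by blast
  then have u: "lead_coeff P dvd 1" using assms(3)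
    by (metis dvd_def lead_coeff_mult)
  have lp: "rat_of_int (lead_coeff P) = of_int a / of_int k"
    using arg_cong[OF eq', of lead_coeff] assms(1) by (simp add: lead_coeff_smult degree_map_poly coeff_map_poly)
  then have eq'': "map_poly of_int P = smult (of_int (lead_coeff P)) p"
    using eq' by simp
  from u have "lead_coeff P = 1 \<or> lead_coeff P = -1"
    by (simp add: zdvd1_eq) linarith
  then show ?thesis
  proof
    assume "lead_coeff P = 1"
    then show ?thesis using eq'' by (metis of_int_1 smult_1_left)
  next
    assume l: "lead_coeff P = -1"
    have "p = map_poly of_int (- P)"
      using eq'' l by (auto simp: poly_eq_iff coeff_map_poly)
    then show ?thesis using l by (metis lead_coeff_minus minus_minus)
  qed
qed

section \<open>Minimal polynomials over the rationals and their integer coefficients\<close>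

lemma map_poly_of_rat_add:
  "map_poly (of_rat :: rat \<Rightarrow> 'a :: field_char_0) (p + q) = map_poly of_rat p + map_poly of_rat q"
  by (intro poly_eqI) (simp add: coeff_map_poly of_rat_add)

lemma map_poly_of_rat_mult:
  "map_poly (of_rat :: rat \<Rightarrow> 'a :: field_char_0) (p * q) = map_poly of_rat p * map_poly of_rat q"
  by (intro poly_eqI) (simp add: coeff_map_poly coeff_mult of_rat_sum of_rat_mult)

text \<open>Otherwise \<open>p\<close> and \<open>r\<close> are coprime, and a Bezout identity
  evaluated at the common root \<open>z\<close> reads 0 = 1.\<close>

lemma irreducible_rat_poly_dvd_if_common_root:
  fixes p r :: "rat poly" and z :: "'a :: field_char_0"
  assumes "irreducible p" "poly (map_poly of_rat p) z = 0" "poly (map_poly of_rat r) z = 0"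
  shows "p dvd r"
proof (rule ccontr)
  assume "\<not> p dvd r"
  then have "coprime p r"
    by (rule prime_elem_imp_coprime[OF field_poly_irreducible_imp_prime[OF assms(1)]])
  then have "fst (bezout_coefficients p r) * p + snd (bezout_coefficients p r) * r = 1"
    by (simp add: bezout_coefficients_fst_snd)
  then obtain u v where "u * p + v * r = 1" by blast
  then have "map_poly of_rat (u * p + v * r) = (1 :: 'a poly)" by simp
  then have "poly (map_poly of_rat u * map_poly of_rat p + map_poly of_rat v * map_poly of_rat r) z = 1"
    by (simp add: map_poly_of_rat_add map_poly_of_rat_mult)
  then show False using assms(2,3) by simp
qed

lemma is_min_poly_algebraic_int:
  fixes \<beta> :: real
  assumes "is_min_poly p (complex_of_real \<beta>)" and "algebraic_int \<beta>"
  shows "\<exists>P. p = map_poly of_int P \<and> lead_coeff P = 1"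
proof -
  obtain Q where Q: "poly (map_poly of_int Q) (complex_of_real \<beta>) = 0" "lead_coeff Q = 1"
    using assms(2) algebraic_int_of_real_iff[of \<beta>] algebraic_int_altdef_ipoly[of "complex_of_real \<beta>"]
    by blast
  have "map_poly of_rat (map_poly rat_of_int Q) = map_poly complex_of_int Q"
    by (simp add: map_poly_map_poly o_def)
  then have "p dvd map_poly of_int Q"
    using irreducible_rat_poly_dvd_if_common_root[of p "complex_of_real \<beta>" "map_poly of_int Q"] Q assms(1)
    by (auto simp: is_min_poly_def)
  then show ?thesis using monic_rat_dvd_monic_int_poly Q assms(1) unfolding is_min_poly_def by blast
qed

text \<open>Reversing the coefficients of a monic integer polynomial that kills the inverse of
  \<beta> gives one that kills \<beta> and has constant term 1. \<open>P\<close> divides it, so the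
  constant term of \<open>P\<close> divides 1.\<close>

lemma is_min_poly_algebraic_unit:
  fixes \<beta> :: real
  assumes "is_min_poly (map_poly of_int P) (complex_of_real \<beta>)" and "lead_coeff P = 1"
    and "algebraic_unit \<beta>"
  shows "coeff P 0 dvd 1"
proof -
  have "algebraic_int (complex_of_real (inverse \<beta>))"
    using assms(3) unfolding algebraic_unit_def algebraic_int_of_real_iff by blast
  then obtain Q where Q: "poly (map_poly of_int Q) (inverse (complex_of_real \<beta>)) = 0" "lead_coeff Q = 1"
    using algebraic_int_altdef_ipoly[of "inverse (complex_of_real \<beta>)"] by auto
  have "reflect_poly (map_poly complex_of_int Q) = map_poly complex_of_int (reflect_poly Q)"
    by (intro poly_eqI) (simp add: coeff_map_poly coeff_reflect_poly degree_map_poly)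
  moreover have "poly (reflect_poly (map_poly complex_of_int Q)) (complex_of_real \<beta>) = 0"
    using Q assms(3) by (simp add: poly_reflect_poly_nz algebraic_unit_def)
  ultimately have "poly (map_poly of_rat (map_poly rat_of_int (reflect_poly Q))) (complex_of_real \<beta>) = 0"
    by (simp add: map_poly_map_poly o_def)
  then have "map_poly rat_of_int P dvd map_poly of_int (reflect_poly Q)"
    using irreducible_rat_poly_dvd_if_common_root assms(1) unfolding is_min_poly_def by blast
  moreover have "content P = 1"
    using content_dvd_coeff[of P "degree P"] assms(2) by (metis normalize_content normalize_1_iff)
  ultimately have "P dvd reflect_poly Q" using primitive_int_poly_dvd_if_rat_dvd by blast
  then have "coeff P 0 dvd coeff (reflect_poly Q) 0"
    by (metis dvd_def coeff_mult_0)
  then show ?thesis using Q by simp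
qed

text \<open>Vieta's formulas for the integral minimal polynomial give norm \<open>c\<close> and
  trace \<open>- b\<close>. The unit property makes \<open>c\<close> equal to 1 or -1, and the signs
  of the two roots select -1.\<close>

lemma negative_conjugate_of_quadratic_unit:
  fixes \<beta> \<beta>' :: real
  assumes "\<beta> > 1" and "quadratic \<beta>" and "algebraic_unit \<beta>"
    and "complex_of_real \<beta>' \<in> conjugates (complex_of_real \<beta>)" and "\<beta>' \<noteq> \<beta>" and "\<beta>' < 0"
  shows "\<beta> * \<beta>' = -1" and "\<exists>m::int. \<beta> + \<beta>' = of_int m" and "\<beta> \<notin> \<rat>"
proof -
  obtain p where p: "is_min_poly p (complex_of_real \<beta>)" and deg: "degree p = 2"
    using assms(2) unfolding quadratic_def by blast
  have int: "algebraic_int \<beta>" using assms(3) by (simp add: algebraic_unit_def)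
  obtain P where P: "p = map_poly of_int P" "lead_coeff P = 1"
    using is_min_poly_algebraic_int[OF p int] by blast
  have degP: "degree P = 2" using deg P by (simp add: degree_map_poly)
  define b c where "b = coeff P 1" and "c = coeff P 0"
  have Peq: "P = [:c, b, 1:]"
    using P(2) degP by (intro poly_eqI)
      (auto simp: b_def c_def coeff_pCons coeff_eq_0 numeral_2_eq_2 split: nat.splits)
  have root: "z\<^sup>2 + of_int b * z + of_int c = 0" if "poly (map_poly of_rat p) (complex_of_real z) = 0" for z
  proof -
    have "complex_of_real (z\<^sup>2 + of_int b * z + of_int c) = 0"
      using that unfolding P(1) Peq by (simp add: map_poly_pCons algebra_simps power2_eq_square)
    then show ?thesis by (simp only: of_real_eq_0_iff)
  qed
  obtain p2 where p2: "is_min_poly p2 (complex_of_real \<beta>)"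
      and r2: "poly (map_poly of_rat p2) (complex_of_real \<beta>') = 0"
    using assms(4) unfolding conjugates_def by blast
  \<comment> \<open>The conjugate comes with its own witness \<open>p2\<close>; divisibility makes
    \<beta>' a root of the quadratic \<open>p\<close> as well.\<close>
  have "p2 dvd p"
    using irreducible_rat_poly_dvd_if_common_root p p2 unfolding is_min_poly_def by blast
  then have r1: "poly (map_poly of_rat p) (complex_of_real \<beta>') = 0"
    using r2 by (auto elim!: dvdE simp: map_poly_of_rat_mult)
  have e1: "\<beta>\<^sup>2 + of_int b * \<beta> + of_int c = 0"
    using root p unfolding is_min_poly_def by blast
  have e2: "\<beta>'\<^sup>2 + of_int b * \<beta>' + of_int c = 0" using root r1 by blast
  have "(\<beta> - \<beta>') * (\<beta> + \<beta>' + of_int b) = 0"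
    using e1 e2 by (simp add: algebra_simps power2_eq_square)
  then have sum: "\<beta> + \<beta>' = - of_int b" using assms(5) by auto
  then have b: "of_int b = - \<beta> - \<beta>'" by simp
  have prod: "\<beta> * \<beta>' = of_int c" using e1 unfolding b by (simp add: algebra_simps power2_eq_square)
  have "c dvd 1" using is_min_poly_algebraic_unit[of P \<beta>] p P assms(3) by (simp add: c_def)
  moreover have "real_of_int c < 0" using prod assms(1,6) by (metis mult_pos_neg less_trans zero_less_one)
  ultimately have "c = -1" by auto
  then show bb: "\<beta> * \<beta>' = -1" using prod by simp
  show "\<exists>m::int. \<beta> + \<beta>' = of_int m" using sum by (metis of_int_minus)
  show "\<beta> \<notin> \<rat>"
  proof
    assume "\<beta> \<in> \<rat>"
    then have "\<beta> \<in> \<int>" using rational_algebraic_int_is_int int by blast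
    then obtain k where k: "\<beta> = of_int k" by (auto elim: Ints_cases)
    \<comment> \<open>An integral \<beta> would make \<beta>' an integer strictly between -1 and
      0.\<close>
    have "\<beta>' = of_int (- b - k)" using sum k by simp
    moreover have "\<beta>' > -1" using bb assms(1,6) mult_strict_right_mono_neg[of 1 \<beta> \<beta>'] by simp
    ultimately have "- 1 < - b - k" "- b - k < 0" using assms(6) by linarith+
    then show False by simp
  qed
qed

section \<open>The natural extension\<close>

text \<open>The numbers \<beta> and \<beta>' are the two roots of X^2 - m X - 1. All later algebra
  rests on this relation and on the irrationality of \<beta>.\<close>

locale quadratic_unit_neg_norm =
  fixes \<beta> \<beta>' :: real and m :: int
  assumes beta_gt_1: "\<beta> > 1" and conj_prod: "\<beta> * \<beta>' = -1"
    and conj_sum: "\<beta> + \<beta>' = of_int m" and irrational: "\<beta> \<notin> \<rat>"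
begin

definition digit :: "real \<Rightarrow> int" where
  "digit x = \<lfloor>- \<beta> * x + \<beta> / (\<beta> + 1)\<rfloor>"

text \<open>The image of the left endpoint under the transformation. It is a fixed point, so the fibres of
  the natural extension can change only there.\<close>

definition brk :: real where
  "brk = (1 - of_int m) / (\<beta> + 1)"

definition ext_dom :: "real \<Rightarrow> real \<Rightarrow> bool" where
  "ext_dom x y \<longleftrightarrow> x \<in> I_beta \<beta> \<and> y \<le> 0 \<and> (if x \<le> brk then - \<beta> - 1 \<le> y else - \<beta> \<le> y)"

definition ext_map :: "real \<times> real \<Rightarrow> real \<times> real" where
  "ext_map = (\<lambda>(x, y). (T_neg \<beta> x, - \<beta>' * y - of_int (digit x)))"

text \<open>Pairs of an element of \<open>(1/q) \<int>[\<beta>]\<close> and its Galois conjugate.\<close>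

definition conj_lattice :: "int \<Rightarrow> (real \<times> real) set" where
  "conj_lattice q = {(x, y). \<exists>a b :: int. of_int q * x = of_int a + of_int b * \<beta> \<and>
                                         of_int q * y = of_int a + of_int b * \<beta>'}"

section \<open>Arithmetic of the two conjugates and the range of the digits\<close>

lemma m_eq: "of_int m = \<beta> + \<beta>'"
  using conj_sum by simp

lemma conj_bounds: "-1 < \<beta>'" "\<beta>' < 0"
proof -
  show "\<beta>' < 0" using conj_prod beta_gt_1
    by (metis less_numeral_extra(1) mult_less_0_iff neg_less_0_iff_less not_less_iff_gr_or_eq order.strict_trans)
  then show "-1 < \<beta>'" using conj_prod mult_strict_right_mono_neg[of 1 \<beta> \<beta>'] beta_gt_1 by simp
qed

lemma m_ge_1: "m \<ge> 1"
proof -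
  have "real_of_int m > 0" unfolding m_eq using conj_bounds beta_gt_1 by simp
  then show ?thesis by simp
qed

text \<open>Norm -1 makes \<beta>' the inverse of -\<beta>. Hence the preimage of
  \<open>(t, s)\<close> under digit \<open>j\<close> is
  \<open>(\<beta>' * (t + of_int j), \<beta> * (s + of_int j))\<close>.\<close>

lemma conj_cancel: "\<beta> * (\<beta>' * z) = - z" "\<beta>' * (\<beta> * z) = - z"
  using conj_prod by (simp_all add: mult.assoc[symmetric] mult.commute)

lemma T_neg_digit: "T_neg \<beta> x = - \<beta> * x - of_int (digit x)"
  by (simp add: T_neg_def digit_def)

lemma neg_expansion_digit: "neg_expansion \<beta> x n = digit ((T_neg \<beta> ^^ n) x)"
  by (simp add: neg_expansion_def digit_def)

lemma I_beta_iff: "x \<in> I_beta \<beta> \<longleftrightarrow> - \<beta> \<le> x * (\<beta> + 1) \<and> x * (\<beta> + 1) < 1"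
  using beta_gt_1 pos_divide_le_eq[of "\<beta> + 1" "- \<beta>" x] pos_less_divide_eq[of "\<beta> + 1" x 1]
  by (simp add: I_beta_def)

text \<open>The interval is a translate of [0, 1), so \<open>T_neg\<close> is a shifted fractional
  part.\<close>

lemma I_beta_iff_shift: "x \<in> I_beta \<beta> \<longleftrightarrow> 0 \<le> x + \<beta> / (\<beta> + 1) \<and> x + \<beta> / (\<beta> + 1) < 1"
proof -
  have "1 / (\<beta> + 1) = 1 - \<beta> / (\<beta> + 1)" using beta_gt_1 by (simp add: field_simps)
  then show ?thesis by (auto simp: I_beta_def)
qed

lemma T_neg_in_I_beta: "T_neg \<beta> x \<in> I_beta \<beta>"
  unfolding I_beta_iff_shift T_neg_def by linarith

lemma digit_nonneg:
  assumes "x \<in> I_beta \<beta>"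
  shows "0 \<le> digit x"
proof -
  have "x \<le> 1 / (\<beta> + 1)" using assms by (simp add: I_beta_def)
  then have "\<beta> * x \<le> \<beta> * (1 / (\<beta> + 1))" using beta_gt_1 by (intro mult_left_mono) auto
  then show ?thesis by (simp add: digit_def)
qed

lemma digit_eq_iff: "digit x = j \<longleftrightarrow> - \<beta> * x - of_int j \<in> I_beta \<beta>"
  unfolding I_beta_iff_shift digit_def floor_eq_iff by auto

lemma le_brk_iff: "x \<le> brk \<longleftrightarrow> x * (\<beta> + 1) \<le> 1 - \<beta> - \<beta>'"
  using beta_gt_1 by (simp add: brk_def m_eq pos_le_divide_eq algebra_simps)

text \<open>The argument of the floor is largest at the left endpoint, where it equals \<beta>; and
  \<beta> < m + 1 because \<beta>' > -1.\<close>

lemma digit_le: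
  assumes "x \<in> I_beta \<beta>"
  shows "digit x \<le> m"
proof -
  have "- x \<le> \<beta> / (\<beta> + 1)" using assms by (simp add: I_beta_def)
  from mult_left_mono[OF this, of \<beta>] have "- \<beta> * x \<le> \<beta> * (\<beta> / (\<beta> + 1))"
    using beta_gt_1 by simp
  then have "- \<beta> * x + \<beta> / (\<beta> + 1) \<le> \<beta>" using beta_gt_1 by (simp add: field_simps)
  also have "\<dots> < of_int m + 1" unfolding m_eq using conj_bounds by simp
  finally show ?thesis unfolding digit_def by linarith
qed

section \<open>Invariance of the domain and its inverse branches\<close>

text \<open>Even on the longer fibre, \<open>- \<beta>' * y\<close> is at least \<beta>' - 1.
  Subtracting a digit up to m stays above -\<beta> - 1, and a digit up to m - 1 stays above
  -\<beta>. So only digit m needs the longer fibre.\<close>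

lemma ext_dom_forward:
  assumes "ext_dom x y"
  shows "ext_dom (T_neg \<beta> x) (- \<beta>' * y - of_int (digit x))"
proof -
  define d where "d = digit x"
  define t where "t = T_neg \<beta> x"
  have x: "x \<in> I_beta \<beta>" and y: "y \<le> 0" "- \<beta> - 1 \<le> y"
    using assms by (auto simp: ext_dom_def split: if_splits)
  have t: "t \<in> I_beta \<beta>" "t = - \<beta> * x - of_int d"
    unfolding t_def d_def by (rule T_neg_in_I_beta, rule T_neg_digit)
  have d: "0 \<le> d" "d \<le> m" using digit_nonneg digit_le x by (simp_all add: d_def)
  have le0: "- \<beta>' * y - of_int d \<le> 0"
  proof -
    have "- \<beta>' * y \<le> 0" using y conj_bounds by (simp add: mult_nonpos_nonpos)
    then show ?thesis using d by linarith
  qed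
  have b1: "- \<beta>' * y \<ge> -1 + \<beta>'"
    using mult_left_mono[OF y(2), of "- \<beta>'"] conj_bounds conj_prod by (simp add: algebra_simps)
  have lo1: "- \<beta> - 1 \<le> - \<beta>' * y - of_int d"
  proof -
    have "real_of_int d \<le> \<beta> + \<beta>'" using d m_eq by (metis of_int_le_iff)
    then show ?thesis using b1 by linarith
  qed
  have lo2: "- \<beta> \<le> - \<beta>' * y - of_int d" if "t > brk"
  proof -
    \<comment> \<open>Under digit m the image is largest at the left endpoint, where it equals
      \<open>brk\<close>.\<close>
    have "d \<noteq> m"
    proof
      assume "d = m"
      then have "t * (\<beta> + 1) = - \<beta> * (x * (\<beta> + 1)) - (\<beta> + \<beta>') * (\<beta> + 1)"
        by (simp add: t m_eq algebra_simps)
      also have "\<dots> \<le> \<beta> * \<beta> - (\<beta> + \<beta>') * (\<beta> + 1)"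
        using x beta_gt_1 mult_left_mono[of "- \<beta>" "x * (\<beta> + 1)" \<beta>] by (simp add: I_beta_iff)
      also have "\<dots> = 1 - \<beta> - \<beta>'" using conj_prod by (simp add: algebra_simps)
      finally show False using that by (simp add: le_brk_iff flip: not_le)
    qed
    with d have d': "d \<le> m - 1" by simp
    then have "real_of_int d \<le> of_int (m - 1)" by (simp only: of_int_le_iff)
    then have d1: "real_of_int d \<le> \<beta> + \<beta>' - 1" by (simp add: m_eq)
    show ?thesis using b1 d1 by linarith
  qed
  show ?thesis using t le0 lo1 lo2 by (simp add: ext_dom_def t_def d_def)
qed

text \<open>The left endpoint of the interval is excluded because its preimage under the digit 0 is the
  right endpoint, which does not belong to the interval.\<close>

lemma ext_dom_backward:
  assumes "ext_dom t s" and "t \<noteq> - \<beta> / (\<beta> + 1)"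
  obtains j where "digit (\<beta>' * (t + of_int j)) = j"
    and "ext_dom (\<beta>' * (t + of_int j)) (\<beta> * (s + of_int j))"
proof -
  have t: "t \<in> I_beta \<beta>" and s: "s \<le> 0" "- \<beta> - 1 \<le> s" and s2: "t > brk \<Longrightarrow> - \<beta> \<le> s"
    using assms by (auto simp: ext_dom_def split: if_splits)
  have tI: "- \<beta> < t * (\<beta> + 1)" "t * (\<beta> + 1) < 1"
    using t assms(2) beta_gt_1 by (auto simp: I_beta_iff order_less_le field_simps)
  have dig: "digit (\<beta>' * (t + of_int j)) = j" for j
    unfolding digit_eq_iff using t by (simp add: conj_cancel)
  have upper: "\<beta>' * (t + of_int j) * (\<beta> + 1) < 1" if "0 \<le> j" for j
  proof -
    have "(t + of_int j) * (\<beta> + 1) = t * (\<beta> + 1) + of_int j * (\<beta> + 1)" by (simp add: algebra_simps)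
    moreover have "0 \<le> of_int j * (\<beta> + 1)" using that beta_gt_1 by simp
    ultimately have "- \<beta> < (t + of_int j) * (\<beta> + 1)" using tI by linarith
    from mult_strict_left_mono_neg[OF this conj_bounds(2)] show ?thesis
      using conj_prod by (simp add: algebra_simps)
  qed
  have lower: "- \<beta> \<le> \<beta>' * (t + of_int j) * (\<beta> + 1)"
    if "(t + of_int j) * (\<beta> + 1) \<le> \<beta> * \<beta>" for j
    using mult_left_mono_neg[OF that, of \<beta>'] conj_bounds by (simp add: conj_cancel mult.assoc)
  have lower': "- \<beta> \<le> \<beta>' * (t + of_int j) * (\<beta> + 1)" if "j \<le> m - 1" for j
  proof (rule lower)
    have "real_of_int j \<le> of_int (m - 1)" using that by (simp only: of_int_le_iff)
    then have "real_of_int j \<le> \<beta> + \<beta>' - 1" by (simp add: m_eq)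
    then have "of_int j * (\<beta> + 1) \<le> (\<beta> + \<beta>' - 1) * (\<beta> + 1)"
      using beta_gt_1 by (intro mult_right_mono) auto
    also have "\<dots> = \<beta> * \<beta> + \<beta>' - 2" using conj_prod by (simp add: algebra_simps)
    finally have "of_int j * (\<beta> + 1) \<le> \<beta> * \<beta> + \<beta>' - 2" .
    then show "(t + of_int j) * (\<beta> + 1) \<le> \<beta> * \<beta>"
      using tI conj_bounds by (simp add: algebra_simps)
  qed
  \<comment> \<open>In the first case a digit below m brings \<open>s\<close> into [-1, 0], so the
    new second coordinate fits every fibre. In the other two it may need the longer fibre, so the
    preimage of \<open>t\<close> must be at most \<open>brk\<close>.\<close>
  consider "- of_int m \<le> s" | "s < - of_int m" "t \<le> brk" | "s < - of_int m" "t > brk"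
    by linarith
  then show thesis
  proof cases
    case 1
    \<comment> \<open>The floor of \<open>- s\<close> works except at \<open>s = - of_int m\<close>,
      where it would be m; there m - 1 gives exactly -1.\<close>
    obtain j where j: "0 \<le> j" "j \<le> m - 1" "-1 \<le> s + of_int j" "s + of_int j \<le> 0"
    proof (cases "s = - of_int m")
      case True
      then show ?thesis using that[of "m - 1"] m_ge_1 by simp
    next
      case False
      have "- of_int m < s" using False 1 by simp
      then show ?thesis using that[of "\<lfloor>- s\<rfloor>"] s(1) by linarith
    qed
    have "- \<beta> \<le> \<beta> * (s + of_int j)" "\<beta> * (s + of_int j) \<le> 0"
      using mult_left_mono[OF j(3), of \<beta>] j(4) beta_gt_1 by (simp_all add: mult_nonneg_nonpos)
    then have "ext_dom (\<beta>' * (t + of_int j)) (\<beta> * (s + of_int j))"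
      using upper[OF j(1)] lower'[OF j(2)] by (simp add: ext_dom_def I_beta_iff)
    then show ?thesis using that dig by blast
  next
    case 2
    have c: "t * (\<beta> + 1) \<le> 1 - \<beta> - \<beta>'" using 2 by (simp add: le_brk_iff)
    have "(t + of_int m) * (\<beta> + 1) \<le> \<beta> * \<beta>"
      using c conj_prod by (simp add: m_eq algebra_simps)
    then have I: "\<beta>' * (t + of_int m) \<in> I_beta \<beta>"
      using lower upper m_ge_1 by (simp add: I_beta_iff)
    have "\<beta>' * (t + of_int m) \<le> brk"
    proof -
      have "(\<beta> + \<beta>' - 1) * \<beta> \<le> (t + of_int m) * (\<beta> + 1)"
        using tI conj_prod conj_bounds beta_gt_1 by (simp add: m_eq algebra_simps)
      from mult_left_mono_neg[OF this, of \<beta>'] conj_bounds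
      have "\<beta>' * (t + of_int m) * (\<beta> + 1) \<le> \<beta>' * ((\<beta> + \<beta>' - 1) * \<beta>)" by (simp add: mult.assoc)
      also have "\<dots> = 1 - \<beta> - \<beta>'" by (simp add: conj_prod conj_cancel algebra_simps)
      finally show ?thesis by (simp add: le_brk_iff)
    qed
    moreover have "\<beta> * (s + of_int m) \<le> 0" using 2 beta_gt_1 by (simp add: mult_nonneg_nonpos)
    moreover have "- \<beta> - 1 \<le> \<beta> * (s + of_int m)"
      using mult_left_mono[of "\<beta>' - 1" "s + of_int m" \<beta>] s(2) beta_gt_1 conj_prod
      by (simp add: m_eq algebra_simps)
    ultimately have "ext_dom (\<beta>' * (t + of_int m)) (\<beta> * (s + of_int m))"
      using I by (simp add: ext_dom_def)
    then show ?thesis using that dig by blast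
  next
    case 3
    define j where "j = m - 1"
    have jr: "real_of_int j = \<beta> + \<beta>' - 1" by (simp add: j_def m_eq)
    have j: "0 \<le> j" "j \<le> m - 1" using m_ge_1 by (simp_all add: j_def)
    have c: "1 - \<beta> - \<beta>' < t * (\<beta> + 1)" using 3 by (simp add: le_brk_iff flip: not_le)
    \<comment> \<open>The branch for digit m - 1 reverses order and fixes \<open>brk\<close>, so it
      carries points above \<open>brk\<close> below it.\<close>
    have "\<beta>' * (t + of_int j) \<le> brk"
    proof -
      have "(\<beta> + \<beta>' - 1) * \<beta> \<le> (t + of_int j) * (\<beta> + 1)"
        using c conj_prod by (simp add: jr algebra_simps)
      from mult_left_mono_neg[OF this, of \<beta>'] conj_bounds
      have "\<beta>' * (t + of_int j) * (\<beta> + 1) \<le> \<beta>' * ((\<beta> + \<beta>' - 1) * \<beta>)" by (simp add: mult.assoc)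
      also have "\<dots> = 1 - \<beta> - \<beta>'" by (simp add: conj_prod conj_cancel algebra_simps)
      finally show ?thesis by (simp add: le_brk_iff)
    qed
    moreover have "\<beta> * (s + of_int j) \<le> 0"
      using 3 beta_gt_1 by (simp add: mult_nonneg_nonpos j_def)
    moreover have "- \<beta> - 1 \<le> \<beta> * (s + of_int j)"
      using mult_left_mono[of "\<beta>' - 1" "s + of_int j" \<beta>] s2 3 beta_gt_1 conj_prod
      by (simp add: jr algebra_simps)
    ultimately have "ext_dom (\<beta>' * (t + of_int j)) (\<beta> * (s + of_int j))"
      using upper[OF j(1)] lower'[OF j(2)] by (simp add: ext_dom_def I_beta_iff)
    then show ?thesis using that dig by blast
  qed
qed

section \<open>The lattice of conjugate pairs\<close>

lemma lin_indep:
  assumes "of_int a + of_int b * \<beta> = 0"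
  shows "a = 0" and "b = 0"
proof -
  show b: "b = 0"
  proof (rule ccontr)
    assume "b \<noteq> 0"
    then have "\<beta> = - of_int a / of_int b" using assms by (simp add: field_simps)
    then have "\<beta> \<in> \<rat>" by simp
    then show False using irrational by simp
  qed
  then show "a = 0" using assms by simp
qed

text \<open>Both conjugates satisfy X^2 = m X + 1, so the same new integer coefficients serve in
  both coordinates.\<close>

lemma conj_lattice_forward:
  assumes "p \<in> conj_lattice q"
  shows "ext_map p \<in> conj_lattice q"
proof -
  obtain x y a b where p: "p = (x, y)" and x: "of_int q * x = of_int a + of_int b * \<beta>"
    and y: "of_int q * y = of_int a + of_int b * \<beta>'"
    using assms by (auto simp: conj_lattice_def)
  define d where "d = digit x"
  have "of_int q * (- \<beta> * x - of_int d) = - \<beta> * (of_int q * x) - of_int q * of_int d"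
    by (simp add: algebra_simps)
  also have "\<dots> = of_int (- b - q * d) + of_int (- a - b * m) * \<beta>"
    unfolding x by (simp add: m_eq conj_prod conj_cancel algebra_simps)
  finally have 1: "of_int q * (- \<beta> * x - of_int d) = of_int (- b - q * d) + of_int (- a - b * m) * \<beta>" .
  have "of_int q * (- \<beta>' * y - of_int d) = - \<beta>' * (of_int q * y) - of_int q * of_int d"
    by (simp add: algebra_simps)
  also have "\<dots> = of_int (- b - q * d) + of_int (- a - b * m) * \<beta>'"
    unfolding y by (simp add: m_eq conj_prod conj_cancel algebra_simps)
  finally have "(- \<beta> * x - of_int d, - \<beta>' * y - of_int d) \<in> conj_lattice q"
    using 1 unfolding conj_lattice_def by blast
  then show ?thesis by (simp add: ext_map_def p T_neg_digit d_def)
qed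

text \<open>The inverse of -\<beta> is \<beta>' = m - \<beta>, again in \<int>[\<beta>], so inverse
  branches need no larger denominator.\<close>

lemma conj_lattice_backward:
  assumes "(t, s) \<in> conj_lattice q"
  shows "(\<beta>' * (t + of_int j), \<beta> * (s + of_int j)) \<in> conj_lattice q"
proof -
  obtain a b where t: "of_int q * t = of_int a + of_int b * \<beta>"
    and s: "of_int q * s = of_int a + of_int b * \<beta>'"
    using assms by (auto simp: conj_lattice_def)
  have "of_int q * (\<beta>' * (t + of_int j)) = \<beta>' * (of_int q * t + of_int q * of_int j)"
    by (simp add: algebra_simps)
  also have "\<dots> = of_int (- b + (a + q * j) * m) + of_int (- (a + q * j)) * \<beta>"
    unfolding t by (simp add: m_eq conj_prod conj_cancel algebra_simps)
  finally have 1: "of_int q * (\<beta>' * (t + of_int j)) = of_int (- b + (a + q * j) * m) + of_int (- (a + q * j)) * \<beta>" .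
  have "of_int q * (\<beta> * (s + of_int j)) = \<beta> * (of_int q * s + of_int q * of_int j)"
    by (simp add: algebra_simps)
  also have "\<dots> = of_int (- b + (a + q * j) * m) + of_int (- (a + q * j)) * \<beta>'"
    unfolding s by (simp add: m_eq conj_prod conj_cancel algebra_simps)
  finally show ?thesis using 1 unfolding conj_lattice_def by blast
qed

text \<open>The conjugate of -\<beta>/(\<beta> + 1) is -\<beta>'/(\<beta>' + 1), which is positive,
  whereas second coordinates in the domain are at most 0. Comparing coefficients yields this
  sign.\<close>

lemma ext_dom_not_left_endpoint:
  assumes "(t, s) \<in> conj_lattice q" and "q > 0" and "ext_dom t s"
  shows "t \<noteq> - \<beta> / (\<beta> + 1)"
proof
  assume "t = - \<beta> / (\<beta> + 1)"
  then have t': "t * (\<beta> + 1) = - \<beta>" using beta_gt_1 by simp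
  obtain a b where t: "of_int q * t = of_int a + of_int b * \<beta>"
    and s: "of_int q * s = of_int a + of_int b * \<beta>'"
    using assms by (auto simp: conj_lattice_def)
  have "(of_int q * t) * (\<beta> + 1) = - of_int q * \<beta>" using t' by (simp add: mult.assoc)
  then have "of_int (a + b) + of_int (a + b + b * m + q) * \<beta> = 0"
    unfolding t by (simp add: m_eq conj_prod conj_cancel algebra_simps)
  then have ab: "a + b = 0" "a + b + b * m + q = 0" using lin_indep by blast+
  have "b * m < 0" using ab assms(2) by simp
  then have "b < 0" using m_ge_1 by (simp add: mult_less_0_iff)
  have "of_int q * s = of_int b * (\<beta>' - 1)"
    using s ab by (simp add: algebra_simps add_eq_0_iff)
  also have "\<dots> > 0" using \<open>b < 0\<close> conj_bounds by (simp add: mult_neg_neg)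
  finally have "s > 0" using assms(2) by (simp add: zero_less_mult_iff)
  then show False using assms(3) by (simp add: ext_dom_def)
qed

section \<open>Finitely many lattice points, permuted by the extension\<close>

definition lattice_dom :: "int \<Rightarrow> (real \<times> real) set" where
  "lattice_dom q = {p \<in> conj_lattice q. ext_dom (fst p) (snd p)}"

lemma finite_lattice_dom:
  assumes "q > 0"
  shows "finite (lattice_dom q)"
proof -
  \<comment> \<open>\<open>B\<close> bounds q |x - y|, since \<open>x\<close> lies in [-1, 1] and
    \<open>y\<close> in [-\<beta> - 1, 0]. As q (x - y) = b (\<beta> - \<beta>') and \<beta> -
    \<beta>' > 1, it bounds |b|; then \<open>K\<close> bounds |a| too.\<close>
  define B where "B = of_int q * (\<beta> + 2)"
  define K where "K = \<lceil>of_int q + B * \<beta>\<rceil>"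
  define f where "f = (\<lambda>(a::int, b::int). ((of_int a + of_int b * \<beta>) / of_int q, (of_int a + of_int b * \<beta>') / of_int q))"
  have "p \<in> f ` ({-K..K} \<times> {-K..K})" if p: "p \<in> lattice_dom q" for p
  proof -
    obtain x y a b where pe: "p = (x, y)" and x: "of_int q * x = of_int a + of_int b * \<beta>"
      and y: "of_int q * y = of_int a + of_int b * \<beta>'" and dom: "ext_dom x y"
      using p by (auto simp: conj_lattice_def lattice_dom_def)
    have xb: "-1 \<le> x" "x \<le> 1"
    proof -
      have "- \<beta> / (\<beta> + 1) \<ge> -1" "1 / (\<beta> + 1) \<le> 1" using beta_gt_1 by (simp_all add: field_simps)
      moreover have "- \<beta> / (\<beta> + 1) \<le> x" "x < 1 / (\<beta> + 1)"
        using dom by (simp_all add: ext_dom_def I_beta_def)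
      ultimately show "-1 \<le> x" "x \<le> 1" by linarith+
    qed
    have yb: "- \<beta> - 1 \<le> y" "y \<le> 0" using dom by (auto simp: ext_dom_def split: if_splits)
    have "\<bar>of_int b\<bar> * 1 \<le> \<bar>of_int b\<bar> * (\<beta> - \<beta>')"
      using beta_gt_1 conj_bounds by (intro mult_left_mono) auto
    also have "\<dots> = \<bar>of_int b * (\<beta> - \<beta>')\<bar>" using beta_gt_1 conj_bounds by (simp add: abs_mult)
    also have "of_int b * (\<beta> - \<beta>') = of_int q * (x - y)" using x y by (simp add: algebra_simps)
    also have "\<bar>of_int q * (x - y)\<bar> = of_int q * \<bar>x - y\<bar>" using assms by (simp add: abs_mult)
    also have "\<dots> \<le> B" unfolding B_def using assms xb yb by (intro mult_left_mono) auto
    finally have b: "\<bar>of_int b\<bar> \<le> B" by simp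
    have "B \<le> B * \<beta>" using b beta_gt_1 by (simp add: mult_le_cancel_left1)
    then have "\<bar>of_int b\<bar> \<le> of_int q + B * \<beta>" using b assms by linarith
    then have bK: "\<bar>b\<bar> \<le> K" unfolding K_def by linarith
    have "\<bar>of_int q * x\<bar> \<le> of_int q" using xb assms by (simp add: abs_mult abs_le_iff)
    moreover have "\<bar>of_int b * \<beta>\<bar> \<le> B * \<beta>"
      using b beta_gt_1 by (simp add: abs_mult)
    ultimately have "\<bar>real_of_int a\<bar> \<le> of_int q + B * \<beta>" using x by linarith
    then have aK: "\<bar>a\<bar> \<le> K" unfolding K_def by linarith
    have "p = f (a, b)" using x y assms by (simp add: pe f_def field_simps)
    then show ?thesis using aK bK by (auto simp: abs_le_iff)
  qed
  then have "lattice_dom q \<subseteq> f ` ({-K..K} \<times> {-K..K})" by blast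
  then show ?thesis by (rule finite_subset) auto
qed

text \<open>The inverse branches give surjectivity; on a finite set injectivity follows by
  counting.\<close>

lemma bij_betw_lattice_dom:
  assumes "q > 0"
  shows "bij_betw ext_map (lattice_dom q) (lattice_dom q)"
proof -
  have sub: "ext_map ` lattice_dom q \<subseteq> lattice_dom q"
    using conj_lattice_forward ext_dom_forward by (force simp: lattice_dom_def ext_map_def)
  have "p \<in> ext_map ` lattice_dom q" if p: "p \<in> lattice_dom q" for p
  proof -
    obtain t s where pe: "p = (t, s)" by fastforce
    have L: "(t, s) \<in> conj_lattice q" and D: "ext_dom t s" using p by (auto simp: pe lattice_dom_def)
    obtain j where j: "digit (\<beta>' * (t + of_int j)) = j"
      "ext_dom (\<beta>' * (t + of_int j)) (\<beta> * (s + of_int j))"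
      using ext_dom_backward[OF D ext_dom_not_left_endpoint[OF L assms D]] .
    let ?r = "(\<beta>' * (t + of_int j), \<beta> * (s + of_int j))"
    have "?r \<in> lattice_dom q" using conj_lattice_backward[OF L] j by (simp add: lattice_dom_def)
    moreover have "ext_map ?r = p"
      using j by (simp add: ext_map_def pe T_neg_digit conj_cancel)
    ultimately show ?thesis by (metis imageI)
  qed
  then have "ext_map ` lattice_dom q = lattice_dom q" using sub by blast
  then show ?thesis
    using finite_lattice_dom[OF assms] by (simp add: bij_betw_def eq_card_imp_inj_on)
qed

section \<open>Periodicity\<close>

lemma fst_ext_map_funpow: "fst ((ext_map ^^ n) (x, y)) = (T_neg \<beta> ^^ n) x"
  by (induction n) (auto simp: ext_map_def case_prod_beta)

lemma rational_in_conj_lattice: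
  assumes "x \<in> \<rat>"
  obtains q where "q > 0" and "(x, x) \<in> conj_lattice q"
proof -
  obtain a b where "b > 0" "x = of_int a / of_int b"
    using assms by (auto elim: Rats_cases')
  then have "of_int b * x = of_int a + of_int 0 * \<beta> \<and> of_int b * x = of_int a + of_int 0 * \<beta>'"
    by simp
  then have "(x, x) \<in> conj_lattice b" unfolding conj_lattice_def by blast
  then show thesis using \<open>b > 0\<close> that by blast
qed

section \<open>Periodic expansions and periodic orbits\<close>

lemma purely_periodic_if_funpow_fixpoint:
  assumes "N > 0" and "(T_neg \<beta> ^^ N) x = x"
  shows "purely_periodic (neg_expansion \<beta> x)"
proof -
  define w where "w = map (neg_expansion \<beta> x) [0..<N]"
  have "neg_expansion \<beta> x n = omega_power w n" for n
    using assms funpow_mod_eq[OF assms(2), of n] by (simp add: omega_power_def w_def neg_expansion_digit)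
  then show ?thesis unfolding purely_periodic_def using assms(1)
    by (intro exI[of _ w]) (auto simp: w_def)
qed

text \<open>While the digits agree, each step multiplies the difference of the two orbits by
  -\<beta>, yet it must stay below the length 1 of the interval.\<close>

lemma eq_if_neg_expansion_eq:
  assumes "x \<in> I_beta \<beta>" "y \<in> I_beta \<beta>" and "neg_expansion \<beta> x = neg_expansion \<beta> y"
  shows "x = y"
proof (rule ccontr)
  assume "x \<noteq> y"
  have diff: "(T_neg \<beta> ^^ n) x - (T_neg \<beta> ^^ n) y = (- \<beta>) ^ n * (x - y)" for n
  proof (induction n)
    case (Suc n)
    have "digit ((T_neg \<beta> ^^ n) x) = digit ((T_neg \<beta> ^^ n) y)"
      using fun_cong[OF assms(3), of n] by (simp add: neg_expansion_digit)
    then have "(T_neg \<beta> ^^ Suc n) x - (T_neg \<beta> ^^ Suc n) y = - \<beta> * ((T_neg \<beta> ^^ n) x - (T_neg \<beta> ^^ n) y)"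
      by (simp add: T_neg_digit algebra_simps)
    then show ?case unfolding Suc.IH by simp
  qed simp
  have mem: "(T_neg \<beta> ^^ n) z \<in> I_beta \<beta>" if "z \<in> I_beta \<beta>" for n z
    using that by (cases n) (simp_all add: T_neg_in_I_beta)
  have lt1: "\<bar>u - v\<bar> < 1" if "u \<in> I_beta \<beta>" "v \<in> I_beta \<beta>" for u v
    using that unfolding I_beta_iff_shift by linarith
  obtain n where "1 / \<bar>x - y\<bar> < \<beta> ^ n" using real_arch_pow[OF beta_gt_1] by blast
  then have "1 < \<beta> ^ n * \<bar>x - y\<bar>" using \<open>x \<noteq> y\<close> by (simp add: pos_divide_less_eq)
  also have "\<dots> = \<bar>(T_neg \<beta> ^^ n) x - (T_neg \<beta> ^^ n) y\<bar>"
    unfolding diff using beta_gt_1 by (simp add: abs_mult power_abs)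
  finally show False using lt1[OF mem mem] assms by (metis less_asym)
qed

text \<open>Shifting by a period leaves the expansion unchanged, and the expansion determines the
  point.\<close>

lemma purely_periodic_iff:
  assumes "x \<in> I_beta \<beta>"
  shows "purely_periodic (neg_expansion \<beta> x) \<longleftrightarrow> (\<exists>N>0. (T_neg \<beta> ^^ N) x = x)"
proof
  assume "purely_periodic (neg_expansion \<beta> x)"
  then obtain w where w: "w \<noteq> []" "neg_expansion \<beta> x = omega_power w"
    by (auto simp: purely_periodic_def)
  define N where "N = length w"
  have N: "N > 0" using w by (simp add: N_def)
  have "neg_expansion \<beta> ((T_neg \<beta> ^^ N) x) n = neg_expansion \<beta> x (n + N)" for n
    by (simp add: neg_expansion_digit funpow_add)
  then have "neg_expansion \<beta> ((T_neg \<beta> ^^ N) x) = neg_expansion \<beta> x"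
    using w by (auto simp: omega_power_def N_def)
  moreover have "(T_neg \<beta> ^^ N) x \<in> I_beta \<beta>"
    using N by (cases N) (simp_all add: T_neg_in_I_beta)
  ultimately have "(T_neg \<beta> ^^ N) x = x" using eq_if_neg_expansion_eq assms by blast
  then show "\<exists>N>0. (T_neg \<beta> ^^ N) x = x" using N by blast
qed (auto intro: purely_periodic_if_funpow_fixpoint)

section \<open>Rational points on either side of 0\<close>

lemma nonpos_rational_purely_periodic:
  assumes "x \<in> \<rat>" and "x \<in> I_beta \<beta>" and "x \<le> 0"
  shows "purely_periodic (neg_expansion \<beta> x)"
proof -
  obtain q where q: "q > 0" "(x, x) \<in> conj_lattice q"
    using rational_in_conj_lattice[OF assms(1)] .
  \<comment> \<open>Thus \<open>(x, x)\<close> lies in the domain even with the shorter fibre,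
    wherever \<open>x\<close> is relative to \<open>brk\<close>.\<close>
  have "- \<beta> / (\<beta> + 1) \<ge> - \<beta>" using beta_gt_1 by (simp add: field_simps)
  then have "- \<beta> \<le> x" using assms(2) by (simp add: I_beta_def)
  then have "(x, x) \<in> lattice_dom q" using assms q by (simp add: lattice_dom_def ext_dom_def)
  then obtain N where "N > 0" "(ext_map ^^ N) (x, x) = (x, x)"
    using finite_bij_betw_funpow_fixpoint[OF finite_lattice_dom bij_betw_lattice_dom] q by blast
  then show ?thesis
    using fst_ext_map_funpow[of N x x] by (intro purely_periodic_if_funpow_fixpoint[of N]) auto
qed

lemma pos_rational_not_purely_periodic:
  assumes "x \<in> \<rat>" and "x \<in> I_beta \<beta>" and "x > 0"
  shows "\<not> purely_periodic (neg_expansion \<beta> x)"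
proof
  assume "purely_periodic (neg_expansion \<beta> x)"
  then obtain N where N: "N > 0" "(T_neg \<beta> ^^ N) x = x" using purely_periodic_iff assms by blast
  obtain q where q: "q > 0" "(x, x) \<in> conj_lattice q"
    using rational_in_conj_lattice[OF assms(1)] .
  define y where "y n = snd ((ext_map ^^ n) (x, x))" for n
  have y_Suc: "y (Suc n) = - \<beta>' * y n - of_int (digit ((T_neg \<beta> ^^ n) x))" for n
    using fst_ext_map_funpow[of n x x] by (simp add: y_def ext_map_def case_prod_beta)
  have y_le: "y n \<le> (- \<beta>') ^ n * x" for n
  proof (induction n)
    case 0
    show ?case by (simp add: y_def)
  next
    case (Suc n)
    have "(T_neg \<beta> ^^ n) x \<in> I_beta \<beta>"
      using assms(2) by (cases n) (simp_all add: T_neg_in_I_beta)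
    then have "y (Suc n) \<le> - \<beta>' * y n" using digit_nonneg by (simp add: y_Suc)
    also have "\<dots> \<le> - \<beta>' * ((- \<beta>') ^ n * x)"
      using Suc conj_bounds by (intro mult_left_mono) auto
    finally show ?case by simp
  qed
  have "(ext_map ^^ n) (x, x) \<in> conj_lattice q" for n
    by (induction n) (simp_all add: q conj_lattice_forward)
  moreover have "(ext_map ^^ N) (x, x) = (x, y N)"
    using fst_ext_map_funpow[of N x x] N by (simp add: y_def prod_eq_iff)
  ultimately have "(x, y N) \<in> conj_lattice q" by metis
  then obtain a b where x: "of_int q * x = of_int a + of_int b * \<beta>"
    and y: "of_int q * y N = of_int a + of_int b * \<beta>'" by (auto simp: conj_lattice_def)
  \<comment> \<open>A rational first coordinate is its own conjugate. So the second coordinate also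
    returns to \<open>x\<close>, against the contraction by \<open>(- \<beta>') ^ N\<close>.\<close>
  have "b = 0"
  proof (rule ccontr)
    assume "b \<noteq> 0"
    then have "\<beta> = (of_int q * x - of_int a) / of_int b" using x by (simp add: field_simps)
    then have "\<beta> \<in> \<rat>" using assms(1) by simp
    then show False using irrational by simp
  qed
  then have "of_int q * y N = of_int q * x" using x y by simp
  then have "y N = x" using q by simp
  moreover have "(- \<beta>') ^ N < 1" using N conj_bounds by (simp add: power_less_one_iff)
  then have "(- \<beta>') ^ N * x < 1 * x" using assms(3) by (intro mult_strict_right_mono)
  ultimately show False using y_le[of N] by simp
qed

end

theorem theorem7:
  fixes \<beta> \<beta>' :: real
  assumes "\<beta> > 1"
    and "quadratic \<beta>" and "pisot \<beta>" and "algebraic_unit \<beta>"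
    and "complex_of_real \<beta>' \<in> conjugates (complex_of_real \<beta>)" and "\<beta>' \<noteq> \<beta>" and "\<beta>' < 0"
  shows "(\<forall>x \<in> \<rat> \<inter> (I_beta \<beta> \<inter> {..0}). purely_periodic (neg_expansion \<beta> x)) \<and>
         (\<forall>x \<in> \<rat> \<inter> (I_beta \<beta> \<inter> {0<..}). \<not> purely_periodic (neg_expansion \<beta> x))"
proof -
  obtain m :: int where "quadratic_unit_neg_norm \<beta> \<beta>' m"
    using negative_conjugate_of_quadratic_unit[of \<beta> \<beta>'] assms
    by (auto simp: quadratic_unit_neg_norm_def)
  then interpret quadratic_unit_neg_norm \<beta> \<beta>' m .
  show ?thesis
    using nonpos_rational_purely_periodic pos_rational_not_purely_periodic by auto
qed

end
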